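(* Let $G=(V,E)$ be a graph with minimum degree $h\ge 1$ and such that $e(S)\le h|S|$ for all $S\subseteq V$. For $0<u\le 1/2$ let $\alpha_u(G)$ be the $u$-expansion of $G$ and define $\delta_u:=\min\{\alpha_u(G)/h,\,1\}$. Then $$q^*(G)\le 1-\inf_{0<u\le 1/2}\left(\frac{\delta_u}{2+\delta_u}+\frac u2\right).$$
   Context: Graphs are finite multigraphs (loops and multiple edges allowed); a loop counts $2$ towards the degree of its vertex. For a graph $G=(V,E)$ and $S\subseteq V$: $\bar S=V\setminus S$; $e(G)=|E|$; $e(S)$ is the number of edges (including loops, with multiplicity) with all endpoints in $S$; $e(S,\bar S)$ is the number of edges with one endpoint in $S$ and the other in $\bar S$; $\mathrm{vol}(S)=\sum_{v\in S}\deg(v)$ and $\mathrm{vol}(G)=\mathrm{vol}(V)$. For $0<u\le1/2$ the $u$-bounded edge expansion ($u$-expansion) of $G$ is $\alpha_u(G)=\min_{S\subseteq V,\ 1\le|S|\le u|V|} e(S,\bar S)/|S|$, with $\alpha_u(G)=\infty$ if $u|V|<1$ (so then $\delta_u=1$). For a graph with at least one edge and a partition $\mathcal A$ of $V$, the modularity score is $$q_{\mathcal A}(G)=\sum_{S\in\mathcal A}\left(\frac{e(S)}{e(G)}-\left(\frac{\mathrm{vol}(S)}{\mathrm{vol}(G)}\right)^2\right),$$ and the modularity of $G$ is $q^*(G)=\max_{\mathcal A}q_{\mathcal A}(G)$, the maximum being over all partitions $\mathcal A$ of $V$. *)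

theory Defs
  imports Complex_Main "HOL-Library.Disjoint_Sets" "HOL-Library.Extended_Real"
begin

text \<open>Edges carry labels, so parallel edges are distinct elements of \<open>edges G\<close>
  with the same end set; a loop is an edge whose end set is a singleton.\<close>

record ('v, 'e) multigraph =
  verts :: "'v set"
  edges :: "'e set"
  ends :: "'e \<Rightarrow> 'v set"

definition finite_multigraph :: "('v, 'e) multigraph \<Rightarrow> bool" where
  "finite_multigraph G \<longleftrightarrow> finite (verts G) \<and> finite (edges G) \<and>
     (\<forall>e\<in>edges G. ends G e \<subseteq> verts G \<and> card (ends G e) \<in> {1, 2})"

definition num_edges :: "('v, 'e) multigraph \<Rightarrow> nat" where
  "num_edges G = card (edges G)"

definition edges_within :: "('v, 'e) multigraph \<Rightarrow> 'v set \<Rightarrow> nat" where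
  "edges_within G S = card {e \<in> edges G. ends G e \<subseteq> S}"

definition edges_between :: "('v, 'e) multigraph \<Rightarrow> 'v set \<Rightarrow> 'v set \<Rightarrow> nat" where
  "edges_between G S T = card {e \<in> edges G. \<exists>x\<in>S. \<exists>y\<in>T. ends G e = {x, y}}"

text \<open>The second summand makes each loop count twice.\<close>

definition degree :: "('v, 'e) multigraph \<Rightarrow> 'v \<Rightarrow> nat" where
  "degree G v = card {e \<in> edges G. v \<in> ends G e} + card {e \<in> edges G. ends G e = {v}}"

definition vol :: "('v, 'e) multigraph \<Rightarrow> 'v set \<Rightarrow> nat" where
  "vol G S = (\<Sum>v\<in>S. degree G v)"

text \<open>Meaningful only for a nonempty vertex set.\<close>

definition min_degree :: "('v, 'e) multigraph \<Rightarrow> nat" where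
  "min_degree G = Min (degree G ` verts G)"

text \<open>For \<open>0 < u\<close> and \<open>u * card (verts G) \<ge> 1\<close> the minimum is over a finite nonempty set.\<close>

definition u_expansion :: "('v, 'e) multigraph \<Rightarrow> real \<Rightarrow> ereal" where
  "u_expansion G u =
     (if u * real (card (verts G)) < 1 then \<infinity>
      else ereal (Min {real (edges_between G S (verts G - S)) / real (card S) | S.
             S \<subseteq> verts G \<and> 1 \<le> card S \<and> real (card S) \<le> u * real (card (verts G))}))"

text \<open>The minimum with 1 is taken in the extended reals, so it is finite (and equal to 1
  when the expansion is infinite) whenever \<open>h > 0\<close>.\<close>

definition delta :: "('v, 'e) multigraph \<Rightarrow> nat \<Rightarrow> real \<Rightarrow> real" where
  "delta G h u = real_of_ereal (min (u_expansion G u / ereal (real h)) 1)"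

definition modularity_score :: "('v, 'e) multigraph \<Rightarrow> 'v set set \<Rightarrow> real" where
  "modularity_score G \<A> =
     (\<Sum>S\<in>\<A>. real (edges_within G S) / real (num_edges G)
        - (real (vol G S) / real (vol G (verts G)))\<^sup>2)"

text \<open>Meaningful only for finite graphs with at least one edge.\<close>

definition modularity :: "('v, 'e) multigraph \<Rightarrow> real" where
  "modularity G = Max {modularity_score G \<A> | \<A>. partition_on (verts G) \<A>}"

end

theory Submission
  imports Defs
begin

text \<open>
  Let \<open>I\<close> be the infimum, and for a part \<open>S\<close> of a partition put \<open>x = vol(S) / vol(G)\<close>. Since the
  numbers \<open>x\<close> add up to 1 over the parts, it suffices that each part contributes at most
  \<open>(1 - I) x\<close> to the modularity score. By double counting, \<open>vol(S) = 2 e(S) + c(S)\<close>, where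
  \<open>c(S)\<close> is the number of edges leaving \<open>S\<close>; in particular \<open>vol(G) = 2 e(G)\<close>.

  For a part with \<open>|S| \<le> |V|/2\<close> take \<open>u = |S|/|V|\<close>. The definition of \<open>u\<close>-expansion and the
  sparsity hypothesis \<open>e(S) \<le> h |S|\<close> give \<open>c(S) \<ge> \<delta>\<^sub>u h |S| \<ge> \<delta>\<^sub>u e(S)\<close>, so \<open>vol(S) \<ge> (2 + \<delta>\<^sub>u) e(S)\<close>. The
  minimum degree and sparsity of the whole graph give \<open>vol(S) \<ge> h |S|\<close> and \<open>vol(G) \<le> 2 h |V|\<close>,
  so \<open>x \<ge> u/2\<close>. Hence the contribution is at most
  \<open>x (2 / (2 + \<delta>\<^sub>u) - x) \<le> x (1 - (\<delta>\<^sub>u / (2 + \<delta>\<^sub>u) + u/2))\<close>.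

  For a part with \<open>|S| > |V|/2\<close> sparsity of the complement controls the cut instead. Letting
  \<open>u\<close> tend to 0, where \<open>\<delta>\<^sub>u = 1\<close>, shows \<open>I \<le> 1/3\<close>, so a bound \<open>2x/3\<close> is enough. If
  \<open>x \<ge> 1/3\<close>, it follows from \<open>e(S)/e(G) \<le> x\<close>. If \<open>x\<close> is smaller, then the complement has large volume on few vertices, and
  sparsity forces that volume to be spent on edges to \<open>S\<close>: this gives \<open>c(S) \<ge> vol(G) - 3 vol(S)\<close>,
  so \<open>e(S)/e(G) \<le> 4x - 1\<close>, and \<open>4x - 1 - x\<^sup>2 \<le> 2x/3\<close> for \<open>x \<le> 1/3\<close>.
\<close>

section \<open>Counting edges through degrees\<close>

lemma edges_between_commute: "edges_between G S T = edges_between G T S"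
  unfolding edges_between_def by (metis insert_commute)

text \<open>Double counting of incidences: an edge inside \<open>S\<close> is counted twice (a loop by the convention
  for degrees), an edge leaving \<open>S\<close> once.\<close>

lemma vol_eq_edges_within_plus_edges_between:
  assumes G: "finite_multigraph G" and S: "S \<subseteq> verts G"
  shows "vol G S = 2 * edges_within G S + edges_between G S (verts G - S)"
proof -
  let ?cross = "\<lambda>e. \<exists>x\<in>S. \<exists>y\<in>verts G - S. ends G e = {x, y}"
  have finE: "finite (edges G)" and finS: "finite S"
    using G S finite_subset by (auto simp: finite_multigraph_def)
  have edge: "(\<Sum>v\<in>S. of_bool (v \<in> ends G e) + of_bool (ends G e = {v}))
      = 2 * of_bool (ends G e \<subseteq> S) + (of_bool (?cross e) :: nat)" if "e \<in> edges G" for e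
  proof -
    have "ends G e \<subseteq> verts G" "card (ends G e) \<in> {1, 2}"
      using G that by (auto simp: finite_multigraph_def)
    then obtain x y where xy: "ends G e = {x, y}" "x \<in> verts G" "y \<in> verts G"
      by (auto simp: card_1_singleton_iff card_2_iff)
    have inc: "of_bool (v \<in> {x, y}) + of_bool ({x, y} = {v})
        = (of_bool (v = x) + of_bool (v = y) :: nat)" for v
      by auto
    have ind: "(\<Sum>v\<in>S. of_bool (v = z)) = (of_bool (z \<in> S) :: nat)" for z
      using finS by (simp add: of_bool_def)
    have cross: "?cross e \<longleftrightarrow> (x \<in> S) \<noteq> (y \<in> S)"
      using xy by (auto simp: doubleton_eq_iff)
    have "(\<Sum>v\<in>S. of_bool (v \<in> ends G e) + of_bool (ends G e = {v}))
        = of_bool (x \<in> S) + (of_bool (y \<in> S) :: nat)"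
      unfolding xy(1) inc sum.distrib ind ..
    also have "\<dots> = 2 * of_bool (ends G e \<subseteq> S) + of_bool (?cross e)"
      unfolding cross by (simp add: xy(1))
    finally show ?thesis .
  qed
  have cnt: "card {e \<in> edges G. P e} = (\<Sum>e\<in>edges G. of_bool (P e))" for P
    using finE by (simp add: Int_def)
  have "vol G S = (\<Sum>v\<in>S. \<Sum>e\<in>edges G. of_bool (v \<in> ends G e) + of_bool (ends G e = {v}))"
    unfolding vol_def degree_def cnt sum.distrib ..
  also have "\<dots> = (\<Sum>e\<in>edges G. \<Sum>v\<in>S. of_bool (v \<in> ends G e) + of_bool (ends G e = {v}))"
    by (rule sum.swap)
  also have "\<dots> = (\<Sum>e\<in>edges G. 2 * of_bool (ends G e \<subseteq> S) + of_bool (?cross e))"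
    by (rule sum.cong[OF refl edge])
  also have "\<dots> = 2 * edges_within G S + edges_between G S (verts G - S)"
    unfolding edges_within_def edges_between_def cnt sum.distrib sum_distrib_left ..
  finally show ?thesis .
qed

lemma edges_within_verts:
  assumes "finite_multigraph G"
  shows "edges_within G (verts G) = num_edges G"
proof -
  have "{e \<in> edges G. ends G e \<subseteq> verts G} = edges G"
    using assms by (auto simp: finite_multigraph_def)
  then show ?thesis
    by (simp add: edges_within_def num_edges_def)
qed

lemma vol_verts:
  assumes "finite_multigraph G"
  shows "vol G (verts G) = 2 * num_edges G"
  using vol_eq_edges_within_plus_edges_between[OF assms order_refl] edges_within_verts[OF assms]
  by (simp add: edges_between_def)

lemma min_degree_mult_card_le_vol:
  assumes "finite_multigraph G" "S \<subseteq> verts G"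
  shows "min_degree G * card S \<le> vol G S"
proof -
  have "min_degree G \<le> degree G v" if "v \<in> S" for v
    using assms that by (auto simp: min_degree_def finite_multigraph_def)
  then show ?thesis
    unfolding vol_def using sum_mono[of S "\<lambda>_. min_degree G" "degree G"]
    by (simp add: mult.commute)
qed

lemma num_edges_pos:
  assumes G: "finite_multigraph G" and "verts G \<noteq> {}" "min_degree G \<ge> 1"
  shows "num_edges G > 0"
proof -
  have "min_degree G * card (verts G) > 0"
    using assms by (auto simp: finite_multigraph_def card_gt_0_iff)
  then show ?thesis
    using min_degree_mult_card_le_vol[OF G order_refl] vol_verts[OF G] by linarith
qed

section \<open>The truncated expansion\<close>

lemma finite_cut_ratios:
  assumes "finite (verts G)"
  shows "finite {real (edges_between G S (verts G - S)) / real (card S) | S.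
      S \<subseteq> verts G \<and> 1 \<le> card S \<and> real (card S) \<le> t}"
proof (rule finite_subset)
  show "finite ((\<lambda>S. real (edges_between G S (verts G - S)) / real (card S)) ` Pow (verts G))"
    using assms by simp
qed auto

lemma delta_eq_one:
  assumes "u * real (card (verts G)) < 1" "h \<ge> 1"
  shows "delta G h u = 1"
  using assms by (simp add: delta_def u_expansion_def)

lemma delta_nonneg:
  assumes fin: "finite (verts G)" and h: "h \<ge> 1"
  shows "0 \<le> delta G h u"
proof (cases "u * real (card (verts G)) < 1")
  case True
  then show ?thesis
    using delta_eq_one[OF True h] by simp
next
  case False
  let ?A = "{real (edges_between G S (verts G - S)) / real (card S) | S.
      S \<subseteq> verts G \<and> 1 \<le> card S \<and> real (card S) \<le> u * real (card (verts G))}"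
  from False have "verts G \<noteq> {}"
    by auto
  then obtain v where "v \<in> verts G"
    by auto
  then have "?A \<noteq> {}"
    using False by (auto intro!: exI[of _ "{v}"])
  then have "Min ?A \<in> ?A"
    by (rule Min_in[OF finite_cut_ratios[OF fin]])
  then have "0 \<le> Min ?A"
    by auto
  then show ?thesis
    using False h by (auto simp: delta_def u_expansion_def real_of_ereal_pos)
qed

text \<open>Truncating the expansion at 1 only lowers it, so \<open>\<delta> h\<close> remains a lower bound for every
  admissible cut ratio.\<close>

lemma delta_mult_card_le_edges_between:
  assumes fin: "finite (verts G)" and h: "h \<ge> 1" and S: "S \<subseteq> verts G" "S \<noteq> {}"
    and u: "real (card S) \<le> u * real (card (verts G))"
  shows "delta G h u * (real h * real (card S)) \<le> real (edges_between G S (verts G - S))"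
proof -
  let ?A = "{real (edges_between G S (verts G - S)) / real (card S) | S.
      S \<subseteq> verts G \<and> 1 \<le> card S \<and> real (card S) \<le> u * real (card (verts G))}"
  have "finite S"
    using S(1) fin by (rule finite_subset)
  then have card: "1 \<le> card S"
    using S(2) by (simp add: Suc_leI card_gt_0_iff)
  then have n: "\<not> u * real (card (verts G)) < 1"
    using u by linarith
  have "Min ?A \<le> real (edges_between G S (verts G - S)) / real (card S)"
    by (rule Min_le[OF finite_cut_ratios[OF fin]]) (use S card u in auto)
  moreover have "delta G h u \<le> Min ?A / real h"
    using n h by (simp add: delta_def u_expansion_def min_def one_ereal_def)
  ultimately have "delta G h u \<le> real (edges_between G S (verts G - S)) / real (card S) / real h"
    using h by (smt (verit) divide_right_mono of_nat_0_le_iff)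
  then show ?thesis
    using h card by (simp add: field_simps)
qed

section \<open>The contribution of one part\<close>

lemma edges_within_ratio_le_vol_ratio:
  assumes "finite_multigraph G" "S \<subseteq> verts G"
  shows "real (edges_within G S) / real (num_edges G) \<le> real (vol G S) / real (vol G (verts G))"
proof (cases "num_edges G = 0")
  case False
  have "2 * real (edges_within G S) \<le> real (vol G S)"
    using vol_eq_edges_within_plus_edges_between[OF assms] by linarith
  then show ?thesis
    using False vol_verts[OF assms(1)] by (simp add: field_simps)
qed simp

text \<open>Parts small enough to be competitors in the definition of the \<open>u\<close>-expansion. The set \<open>S\<close> is
  itself the witness, with the smallest \<open>u\<close> that admits it, so that the loss \<open>\<delta>/(2 + \<delta>)\<close>, caused
  by the cut, and the loss \<open>u/2\<close>, caused by the squared volume, refer to the same \<open>u\<close>.\<close>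

lemma score_small_part:
  fixes G :: "('v, 'e) multigraph"
  assumes G: "finite_multigraph G" and h: "min_degree G \<ge> 1"
    and sparse: "\<And>S. S \<subseteq> verts G \<Longrightarrow> edges_within G S \<le> min_degree G * card S"
    and S: "S \<subseteq> verts G" "S \<noteq> {}"
  defines "u \<equiv> real (card S) / real (card (verts G))"
  defines "d \<equiv> delta G (min_degree G) u"
  defines "x \<equiv> real (vol G S) / real (vol G (verts G))"
  shows "real (edges_within G S) / real (num_edges G) - x\<^sup>2 \<le> x * (1 - (d / (2 + d) + u / 2))"
proof -
  let ?h = "real (min_degree G)" and ?n = "real (card (verts G))" and ?m = "real (num_edges G)"
  have fin: "finite (verts G)"
    using G by (simp add: finite_multigraph_def)
  have n: "?n > 0"
    using fin S by (auto simp: card_gt_0_iff)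
  have m: "?m > 0"
    unfolding of_nat_0_less_iff using num_edges_pos[OF G _ h] S by blast
  have x: "x = real (vol G S) / (2 * ?m)"
    using vol_verts[OF G] by (simp add: x_def)
  have d: "0 \<le> d"
    unfolding d_def by (rule delta_nonneg[OF fin h])
  have "d * (?h * real (card S)) \<le> real (edges_between G S (verts G - S))"
    unfolding d_def by (rule delta_mult_card_le_edges_between[OF fin h S]) (use n in \<open>simp add: u_def\<close>)
  moreover have "real (edges_within G S) \<le> ?h * real (card S)"
    using sparse[OF S(1)] by (metis of_nat_mono of_nat_mult)
  then have "d * real (edges_within G S) \<le> d * (?h * real (card S))"
    by (rule mult_left_mono[OF _ d])
  ultimately have "(2 + d) * real (edges_within G S) \<le> real (vol G S)"
    using vol_eq_edges_within_plus_edges_between[OF G S(1)] by (simp add: algebra_simps)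
  then have "real (edges_within G S) / ?m \<le> real (vol G S) / (2 + d) / ?m"
    using d m by (intro divide_right_mono) (auto simp: field_simps)
  also have "\<dots> = x * (2 / (2 + d))"
    by (simp add: x)
  also have "2 / (2 + d) = 1 - d / (2 + d)"
    using d by (simp add: field_simps)
  finally have inner: "real (edges_within G S) / ?m \<le> x * (1 - d / (2 + d))" .
  have "?m \<le> ?h * ?n"
    using sparse[OF order_refl] edges_within_verts[OF G] by (metis of_nat_mono of_nat_mult)
  then have "real (card S) * ?m \<le> real (card S) * (?h * ?n)"
    by (rule mult_left_mono) simp
  also have "\<dots> = (?h * real (card S)) * ?n"
    by simp
  also have "\<dots> \<le> real (vol G S) * ?n"
    using min_degree_mult_card_le_vol[OF G S(1)]
    by (intro mult_right_mono) (metis of_nat_mono of_nat_mult, simp)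
  finally have "u / 2 \<le> x"
    using n m by (simp add: u_def x field_simps)
  moreover have "0 \<le> x"
    by (simp add: x_def)
  ultimately have "x * (u / 2) \<le> x\<^sup>2"
    unfolding power2_eq_square by (rule mult_left_mono)
  with inner show ?thesis
    by (simp add: algebra_simps)
qed

text \<open>The complement \<open>T\<close> of \<open>S\<close> has no more vertices than \<open>S\<close>, so sparsity bounds \<open>2 e(T)\<close> by
  \<open>2 h |T| \<le> 2 h |S| \<le> 2 vol(S)\<close>; the rest of \<open>vol(T) = vol(G) - vol(S)\<close> lies in the cut.\<close>

lemma edges_between_majority_ge:
  fixes G :: "('v, 'e) multigraph"
  assumes G: "finite_multigraph G"
    and sparse: "\<And>S. S \<subseteq> verts G \<Longrightarrow> edges_within G S \<le> min_degree G * card S"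
    and S: "S \<subseteq> verts G" "card (verts G - S) \<le> card S"
  shows "vol G (verts G) \<le> 3 * vol G S + edges_between G S (verts G - S)"
proof -
  let ?T = "verts G - S"
  have "finite (verts G)"
    using G by (simp add: finite_multigraph_def)
  then have "vol G (verts G) = vol G ?T + vol G S"
    unfolding vol_def using S(1) by (simp add: sum.subset_diff)
  moreover have "verts G - ?T = S"
    using S(1) by auto
  then have "vol G ?T = 2 * edges_within G ?T + edges_between G S ?T"
    using vol_eq_edges_within_plus_edges_between[OF G, of ?T] edges_between_commute[of G S ?T]
    by simp
  moreover have "edges_within G ?T \<le> min_degree G * card S"
    using sparse[of ?T] mult_le_mono2[OF S(2)] by (meson Diff_subset le_trans)
  ultimately show ?thesis
    using min_degree_mult_card_le_vol[OF G S(1)] by linarith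
qed

text \<open>The constant \<open>2/3\<close> is \<open>1 - \<delta>/(2 + \<delta>)\<close> at \<open>\<delta> = 1\<close>. The bounds \<open>x\<close> and \<open>4x - 1\<close> on
  \<open>e(S)/e(G)\<close> agree at \<open>x = 1/3\<close>, where the inequality below is tight for both.\<close>

lemma score_large_part:
  fixes G :: "('v, 'e) multigraph"
  assumes G: "finite_multigraph G"
    and sparse: "\<And>S. S \<subseteq> verts G \<Longrightarrow> edges_within G S \<le> min_degree G * card S"
    and S: "S \<subseteq> verts G" "card (verts G - S) \<le> card S"
  defines "x \<equiv> real (vol G S) / real (vol G (verts G))"
  shows "real (edges_within G S) / real (num_edges G) - x\<^sup>2 \<le> 2 / 3 * x"
proof (cases "x \<ge> 1 / 3")
  case True
  have "0 \<le> x"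
    by (simp add: x_def)
  then have "x * (1 / 3) \<le> x * x"
    by (rule mult_left_mono[OF True])
  then have "x - x\<^sup>2 \<le> 2 / 3 * x"
    by (simp add: power2_eq_square)
  then show ?thesis
    using edges_within_ratio_le_vol_ratio[OF G S(1)] unfolding x_def by linarith
next
  case False
  show ?thesis
  proof (cases "num_edges G = 0")
    case m: False
    have x: "2 * real (num_edges G) * x = real (vol G S)"
      using m vol_verts[OF G] by (simp add: x_def)
    have "real (vol G (verts G)) \<le> 3 * real (vol G S) + real (edges_between G S (verts G - S))"
      using edges_between_majority_ge[OF G sparse S] by linarith
    then have "real (edges_within G S) \<le> 2 * real (vol G S) - real (num_edges G)"
      using vol_eq_edges_within_plus_edges_between[OF G S(1)] vol_verts[OF G] by linarith
    also have "\<dots> = (4 * x - 1) * real (num_edges G)"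
      using x by (simp add: algebra_simps)
    finally have "real (edges_within G S) / real (num_edges G) \<le> 4 * x - 1"
      using m by (simp add: field_simps)
    moreover have "0 \<le> (1 / 3 - x) * (3 - x)"
      using False by simp
    moreover have "(1 / 3 - x) * (3 - x) = 2 / 3 * x - (4 * x - 1 - x\<^sup>2)"
      by (simp add: field_simps power2_eq_square)
    ultimately show ?thesis
      by linarith
  qed (simp add: x_def vol_verts[OF G])
qed

section \<open>Summing over a partition\<close>

text \<open>The parts of a partition share out the total volume, so a bound proportional to volume on
  each part's contribution becomes a bound on the modularity.\<close>

lemma modularity_leI:
  assumes G: "finite_multigraph G" and V: "verts G \<noteq> {}" and m: "num_edges G > 0"
    and part: "\<And>S. S \<subseteq> verts G \<Longrightarrow> S \<noteq> {} \<Longrightarrow>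
      real (edges_within G S) / real (num_edges G) - (real (vol G S) / real (vol G (verts G)))\<^sup>2
        \<le> real (vol G S) / real (vol G (verts G)) * c"
  shows "modularity G \<le> c"
proof -
  let ?Q = "{modularity_score G \<A> | \<A>. partition_on (verts G) \<A>}"
  have fin: "finite (verts G)"
    using G by (simp add: finite_multigraph_def)
  have "?Q = modularity_score G ` {\<A>. partition_on (verts G) \<A>}"
    by auto
  then have "finite ?Q"
    using finitely_many_partition_on[OF fin] by simp
  moreover have "?Q \<noteq> {}"
    using partition_on_space[OF V] by auto
  moreover have "modularity_score G \<A> \<le> c" if \<A>: "partition_on (verts G) \<A>" for \<A>
  proof -
    have "modularity_score G \<A> \<le> (\<Sum>S\<in>\<A>. real (vol G S) / real (vol G (verts G)) * c)"
      unfolding modularity_score_def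
      by (intro sum_mono part) (use \<A> in \<open>auto simp: partition_on_def\<close>)
    also have "\<dots> = real (\<Sum>S\<in>\<A>. vol G S) / real (vol G (verts G)) * c"
      by (simp add: sum_distrib_right sum_divide_distrib)
    also have "(\<Sum>S\<in>\<A>. vol G S) = vol G (\<Union>\<A>)"
    proof -
      have "\<forall>S\<in>\<A>. finite S"
        using \<A> finite_subset[OF _ fin] by (auto simp: partition_on_def)
      moreover have "disjoint \<A>"
        using \<A> by (simp add: partition_on_def)
      ultimately have "sum (degree G) (\<Union>\<A>) = (sum \<circ> sum) (degree G) \<A>"
        by (rule sum.Union_disjoint_sets)
      then show ?thesis
        unfolding vol_def by simp
    qed
    also have "\<Union>\<A> = verts G"
      using \<A> by (simp add: partition_on_def)
    finally show ?thesis
      using m vol_verts[OF G] by simp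
  qed
  ultimately show ?thesis
    unfolding modularity_def by (subst Max_le_iff) auto
qed

theorem theorem1p9:
  fixes G :: "('v, 'e) multigraph" and h :: nat
  assumes "finite_multigraph G"
    and "verts G \<noteq> {}"
    and "min_degree G = h"
    and "h \<ge> 1"
    and "\<And>S. S \<subseteq> verts G \<Longrightarrow> edges_within G S \<le> h * card S"
  shows "modularity G \<le> 1 - (INF u\<in>{0<..1/2::real}. delta G h u / (2 + delta G h u) + u / 2)"
proof -
  let ?f = "\<lambda>u. delta G h u / (2 + delta G h u) + u / 2"
  define I where "I = (INF u\<in>{0<..1/2::real}. ?f u)"
  let ?n = "real (card (verts G))"
  have h: "min_degree G \<ge> 1"
    and sparse: "\<And>S. S \<subseteq> verts G \<Longrightarrow> edges_within G S \<le> min_degree G * card S"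
    using assms by auto
  have fin: "finite (verts G)"
    using assms(1) by (simp add: finite_multigraph_def)
  have n: "?n > 0"
    using fin assms(2) by (simp add: card_gt_0_iff)
  have "bdd_below (?f ` {0<..1/2})"
    using delta_nonneg[OF fin assms(4)] by (intro bdd_belowI2[of _ 0]) (auto intro!: add_nonneg_nonneg)
  then have I_le: "I \<le> ?f u" if "u \<in> {0<..1/2}" for u
    unfolding I_def using that by (rule cINF_lower)
  have I_third: "I \<le> 1 / 3"
  proof (rule field_le_epsilon)
    fix e :: real
    assume e: "0 < e"
    \<comment> \<open>Below \<open>1 / |V|\<close> no vertex set competes in the expansion, so \<open>\<delta> = 1\<close>.\<close>
    define u where "u = min e (1 / (2 * ?n))"
    have u_le_e: "u \<le> e"
      by (simp add: u_def)
    have u_le: "u \<le> 1 / (2 * ?n)"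
      by (simp add: u_def)
    also have "\<dots> \<le> 1 / 2"
      using n by (simp add: field_simps)
    finally have "u \<le> 1 / 2" .
    moreover have "0 < u"
      using e n by (simp add: u_def)
    ultimately have u: "u \<in> {0<..1/2}"
      by simp
    have "u * ?n \<le> 1 / (2 * ?n) * ?n"
      by (rule mult_right_mono[OF u_le]) simp
    then have "u * ?n < 1"
      using n by simp
    then have "delta G h u = 1"
      using assms(4) by (rule delta_eq_one)
    then have "I \<le> 1 / 3 + u / 2"
      using I_le[OF u] by simp
    also have "\<dots> \<le> 1 / 3 + e"
      using e u_le_e by linarith
    finally show "I \<le> 1 / 3 + e" .
  qed
  have "modularity G \<le> 1 - I"
  proof (rule modularity_leI[OF assms(1,2) num_edges_pos[OF assms(1,2) h]])
    fix S
    assume S: "S \<subseteq> verts G" "S \<noteq> {}"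
    let ?x = "real (vol G S) / real (vol G (verts G))"
    let ?s = "real (edges_within G S) / real (num_edges G) - ?x\<^sup>2"
    have x: "0 \<le> ?x"
      by simp
    show "?s \<le> ?x * (1 - I)"
    proof (cases "2 * card S \<le> card (verts G)")
      case True
      let ?u = "real (card S) / ?n"
      have "card S > 0"
        using S fin finite_subset by (auto simp: card_gt_0_iff)
      then have "?u \<in> {0<..1/2}"
        using n True by (simp add: field_simps)
      then have "1 - ?f ?u \<le> 1 - I"
        by (intro diff_left_mono I_le)
      then have "?x * (1 - ?f ?u) \<le> ?x * (1 - I)"
        by (rule mult_left_mono[OF _ x])
      moreover have "?s \<le> ?x * (1 - ?f ?u)"
        using score_small_part[OF assms(1) h sparse S] unfolding assms(3) .
      ultimately show ?thesis
        by linarith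
    next
      case False
      then have "card (verts G - S) \<le> card S"
        using S(1) fin by (simp add: card_Diff_subset finite_subset)
      then have "?s \<le> 2 / 3 * ?x"
        by (intro score_large_part[OF assms(1) _ S(1)] sparse)
      also have "\<dots> \<le> (1 - I) * ?x"
        by (rule mult_right_mono[OF _ x]) (use I_third in simp)
      finally show ?thesis
        by (simp add: mult.commute)
    qed
  qed
  then show ?thesis
    by (simp add: I_def)
qed

end
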